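(* For $0\le i\le k\le n$, $n\ge1$, we have the identity $$\check\Phi(n,k,i)=\sum_{j=0}^{i}(-1)^j\cdot\binom ij\cdot\check\Phi(n,k-j,0).$$
   Context: A quasi-graded poset $(P,\rho,\bar\zeta)$ consists of a finite poset $P$, a function $\rho:P\to\mathbb N$ with $x<y\Rightarrow\rho(x)<\rho(y)$, and a function $\bar\zeta$ in the incidence algebra of $P$ with $\bar\zeta(x,x)=1$. Write $\rho(x,y)=\rho(y)-\rho(x)$. If $P$ has minimal element $\hat0$ and maximal element $\hat1$, $\hat0<\hat1$, its $\mathbf{ab}$-index is the polynomial in non-commuting variables $\mathbf a,\mathbf b$ $$\Psi(P)=\sum\bar\zeta(x_0,x_1)\cdots\bar\zeta(x_{k-1},x_k)\cdot(\mathbf a-\mathbf b)^{\rho(x_0,x_1)-1}\,\mathbf b\,(\mathbf a-\mathbf b)^{\rho(x_1,x_2)-1}\,\mathbf b\cdots\mathbf b\,(\mathbf a-\mathbf b)^{\rho(x_{k-1},x_k)-1},$$ summed over all chains $\hat0=x_0<x_1<\cdots<x_k=\hat1$. Semisuspension. For $n\ge1$ and a finite simplicial complex $\Delta$ (containing $\emptyset$) with $\dim\Delta<n$, $\mathrm{Semi}(\Delta,n)$ is obtained by embedding $\Delta$ in the boundary of an $n$-ball; its face poset $\mathcal F(\mathrm{Semi}(\Delta,n))$ is the following quasi-graded poset, independent of the embedding: the elements are the faces of $\Delta$ (with $\hat0=\emptyset$) and two further elements $*$ and $\hat1$; $\rho(F)=\dim F+1$, $\rho( * )=n$, $\rho(\hat1)=n+1$;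 faces are ordered by inclusion, every other element is $<\hat1$, and $F<*$ for every face $F$ with $\rho(F)<n$ (faces of dimension $n-1$ are incomparable to $*$); $$\bar\zeta(F,* )=1+(-1)^{n-\rho(F)}\,\widetilde\chi(\mathrm{link}_\Delta(F)),\qquad\widetilde\chi(\mathrm{link}_\Delta(F))=\sum_{H\in\Delta,\,H\supseteq F}(-1)^{\dim H-\dim F-1},$$ and $\bar\zeta=1$ on all other intervals. For $0\le i\le k$, $\Delta_{k,i}$ is the simplicial complex generated by $i+1$ of the facets of the $k$-dimensional simplex (so $\dim\Delta_{k,i}=k-1$, and $\Delta_{0,0}=\{\emptyset\}$). For $0\le i\le k\le n$ let $P_{n,k,i}=\mathcal F(\mathrm{Semi}(\Delta_{k,i},n))$. The $\mathbf{cd}$-indexes of the simplicial shelling components are $\check\Phi(n,k,0)=\Psi(P_{n,k,0})$ and $\check\Phi(n,k,i)=\Psi(P_{n,k,i})-\Psi(P_{n,k,i-1})$ for $1\le i\le k\le n$. *)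

theory Defs
  imports
    "HOL-Library.Poly_Mapping"
    "HOL-Algebra.Order"
begin

section \<open>Polynomials in the non-commuting variables a and b\<close>

datatype ab = A | B

text \<open>Finite words with concatenation, written additively: \<^typ>\<open>'k \<Rightarrow>\<^sub>0 'r\<close> becomes a
  (possibly non-commutative) monoid ring once its exponents form a \<^class>\<open>monoid_add\<close>.\<close>

datatype ab_word = Word "ab list"

instantiation ab_word :: monoid_add
begin

definition zero_ab_word :: ab_word where
  "0 = Word []"

fun plus_ab_word :: "ab_word \<Rightarrow> ab_word \<Rightarrow> ab_word" where
  "Word u + Word v = Word (u @ v)"

instance
proof
  fix x y z :: ab_word
  show "x + y + z = x + (y + z)"
    by (cases x; cases y; cases z) simp
  show "0 + x = x" "x + 0 = x"
    by (cases x; simp add: zero_ab_word_def)+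
qed

end

type_synonym 'r ab_poly = "ab_word \<Rightarrow>\<^sub>0 'r"

definition avar :: "'r::field ab_poly" where
  "avar = Poly_Mapping.single (Word [A]) 1"

definition bvar :: "'r::field ab_poly" where
  "bvar = Poly_Mapping.single (Word [B]) 1"

definition const_ab :: "'r::field \<Rightarrow> 'r ab_poly" where
  "const_ab c = Poly_Mapping.single 0 c"


section \<open>Quasi-graded posets and the ab-index\<close>

text \<open>An element of the incidence algebra is a function on intervals; only the values
  \<open>zeta P x y\<close> with \<open>x\<close> below or equal to \<open>y\<close> in the carrier are meaningful.\<close>

record ('a, 'r) qg_poset = "'a gorder" +
  rk :: "'a \<Rightarrow> nat"
  zeta :: "'a \<Rightarrow> 'a \<Rightarrow> 'r"

locale quasi_graded_poset = partial_order P
  for P :: "('a, 'r::field) qg_poset" (structure) +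
  assumes finite_carrier: "finite (carrier P)"
    and rk_strict: "\<lbrakk>x \<in> carrier P; y \<in> carrier P; x \<sqsubset> y\<rbrakk> \<Longrightarrow> rk P x < rk P y"
    and zeta_refl: "x \<in> carrier P \<Longrightarrow> zeta P x x = 1"

definition chains :: "('a, 'r) qg_poset \<Rightarrow> 'a list set" where
  "chains P = {xs. xs \<noteq> [] \<and> set xs \<subseteq> carrier P \<and> sorted_wrt (lless P) xs
                  \<and> hd xs = \<bottom>\<^bsub>P\<^esub> \<and> last xs = \<top>\<^bsub>P\<^esub>}"

text \<open>Differences of ranks along a chain are positive, so truncated subtraction is harmless.
  One-element chains only occur if bottom and top coincide.\<close>

fun chain_term :: "('a, 'r::field) qg_poset \<Rightarrow> 'a list \<Rightarrow> 'r ab_poly" where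
  "chain_term P (x # y # z # zs) =
     const_ab (zeta P x y) * (avar - bvar) ^ (rk P y - rk P x - 1) * bvar
       * chain_term P (y # z # zs)"
| "chain_term P [x, y] =
     const_ab (zeta P x y) * (avar - bvar) ^ (rk P y - rk P x - 1)"
| "chain_term P _ = 1"

definition ab_index :: "('a, 'r::field) qg_poset \<Rightarrow> 'r ab_poly" where
  "ab_index P = (\<Sum>xs \<in> chains P. chain_term P xs)"


section \<open>Simplicial complexes and their semisuspensions\<close>

definition simplicial_complex :: "'v set set \<Rightarrow> bool" where
  "simplicial_complex \<Delta> \<longleftrightarrow> finite \<Delta> \<and> (\<forall>F\<in>\<Delta>. finite F) \<and> {} \<in> \<Delta>
     \<and> (\<forall>F\<in>\<Delta>. \<forall>G. G \<subseteq> F \<longrightarrow> G \<in> \<Delta>)"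

definition face_dim :: "'v set \<Rightarrow> int" where
  "face_dim F = int (card F) - 1"

definition link_euler :: "'v set set \<Rightarrow> 'v set \<Rightarrow> 'r::field" where
  "link_euler \<Delta> F =
     (\<Sum>H | H \<in> \<Delta> \<and> F \<subseteq> H. (-1) powi (face_dim H - face_dim F - 1))"

datatype 'v semi_elem = Face "'v set" | Star | One

fun semi_le :: "nat \<Rightarrow> 'v semi_elem \<Rightarrow> 'v semi_elem \<Rightarrow> bool" where
  "semi_le n (Face F) (Face G) \<longleftrightarrow> F \<subseteq> G"
| "semi_le n (Face F) Star \<longleftrightarrow> card F < n"
| "semi_le n Star Star \<longleftrightarrow> True"
| "semi_le n x One \<longleftrightarrow> True"
| "semi_le n _ _ \<longleftrightarrow> False"

fun semi_rk :: "nat \<Rightarrow> 'v semi_elem \<Rightarrow> nat" where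
  "semi_rk n (Face F) = nat (face_dim F + 1)"
| "semi_rk n Star = n"
| "semi_rk n One = n + 1"

fun semi_zeta :: "'v set set \<Rightarrow> nat \<Rightarrow> 'v semi_elem \<Rightarrow> 'v semi_elem \<Rightarrow> 'r::field" where
  "semi_zeta \<Delta> n (Face F) Star = 1 + (-1) ^ (n - semi_rk n (Face F)) * link_euler \<Delta> F"
| "semi_zeta \<Delta> n _ _ = 1"

definition semi_face_poset :: "'v set set \<Rightarrow> nat \<Rightarrow> ('v semi_elem, 'r::field) qg_poset" where
  "semi_face_poset \<Delta> n =
     \<lparr> carrier = Face ` \<Delta> \<union> {Star, One}, eq = (=), le = semi_le n,
       rk = semi_rk n, zeta = semi_zeta \<Delta> n \<rparr>"

lemma semi_rk_Face: "semi_rk n (Face F) = card F"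
  by (simp add: face_dim_def)

lemma semi_le_refl: "semi_le n x x"
  by (cases x) auto

lemma semi_le_trans:
  assumes "semi_le n x y" "semi_le n y z" "\<And>F. y = Face F \<Longrightarrow> finite F"
  shows "semi_le n x z"
  using assms by (cases x; cases y; cases z) (auto dest: card_mono)

lemma semi_le_antisym: "semi_le n x y \<Longrightarrow> semi_le n y x \<Longrightarrow> x = y"
  by (cases x; cases y) auto

lemma quasi_graded_semi_face_poset:
  assumes "simplicial_complex \<Delta>" and dim: "\<And>F. F \<in> \<Delta> \<Longrightarrow> face_dim F < int n"
  shows "quasi_graded_poset (semi_face_poset \<Delta> n :: ('v semi_elem, 'r::field) qg_poset)"
proof -
  have fin: "finite \<Delta>" "\<And>F. F \<in> \<Delta> \<Longrightarrow> finite F"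
    using assms(1) by (auto simp: simplicial_complex_def)
  have card: "card F \<le> n" if "F \<in> \<Delta>" for F
    using dim[OF that] by (simp add: face_dim_def)
  let ?P = "semi_face_poset \<Delta> n :: ('v semi_elem, 'r) qg_poset"
  have Face_fin: "finite F" if "Face F \<in> carrier ?P" for F
    using that fin by (auto simp: semi_face_poset_def)
  show ?thesis
  proof unfold_locales
    fix x y z
    assume "x \<sqsubseteq>\<^bsub>?P\<^esub> y" "y \<sqsubseteq>\<^bsub>?P\<^esub> z" "y \<in> carrier ?P"
    then show "x \<sqsubseteq>\<^bsub>?P\<^esub> z"
      using semi_le_trans[of n x y z] Face_fin by (auto simp: semi_face_poset_def)
  next
    fix x y
    assume xy: "x \<sqsubseteq>\<^bsub>?P\<^esub> y" "y \<sqsubseteq>\<^bsub>?P\<^esub> x"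
    then show "x .=\<^bsub>?P\<^esub> y"
      using semi_le_antisym[of n x y] by (simp add: semi_face_poset_def)
  next
    fix x y
    assume car: "x \<in> carrier ?P" "y \<in> carrier ?P" and less: "x \<sqsubset>\<^bsub>?P\<^esub> y"
    have xy: "semi_le n x y" "x \<noteq> y"
      using less by (simp_all add: lless_def semi_face_poset_def)
    have "semi_rk n x < semi_rk n y"
    proof (cases x)
      case (Face F)
      then have F: "F \<in> \<Delta>"
        using car by (auto simp: semi_face_poset_def)
      show ?thesis
      proof (cases y)
        case (Face G)
        then have "G \<in> \<Delta>" "F \<subset> G"
          using car xy \<open>x = Face F\<close> by (auto simp: semi_face_poset_def)
        then show ?thesis
          using fin psubset_card_mono[of G F] Face \<open>x = Face F\<close> by (simp add: semi_rk_Face del: semi_rk.simps(1))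
      qed (use xy Face card[OF F] in \<open>auto simp: less_Suc_eq_le semi_rk_Face simp del: semi_rk.simps(1)\<close>)
    qed (use xy in \<open>cases y; simp\<close>)+
    then show "rk ?P x < rk ?P y"
      by (simp add: semi_face_poset_def)
  next
    fix x :: "'v semi_elem"
    show "zeta ?P x x = (1 :: 'r)"
      by (cases x) (simp_all add: semi_face_poset_def)
  qed (use fin in \<open>simp_all add: semi_face_poset_def semi_le_refl\<close>)
qed

lemma bottom_top_semi_face_poset:
  fixes \<Delta> :: "'v set set" and n :: nat
  defines "P \<equiv> semi_face_poset \<Delta> n :: ('v semi_elem, 'r::field) qg_poset"
  assumes "simplicial_complex \<Delta>" and "n \<ge> 1"
  shows "\<bottom>\<^bsub>P\<^esub> = Face {}" "\<top>\<^bsub>P\<^esub> = One"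
proof -
  have car: "Face {} \<in> carrier P" "One \<in> carrier P" and le: "le P = semi_le n"
    using assms(2) by (auto simp: P_def semi_face_poset_def simplicial_complex_def)
  have bot: "semi_le n (Face {}) x" for x :: "'v semi_elem"
    using assms(3) by (cases x) auto
  have top: "semi_le n x One" for x :: "'v semi_elem"
    by (cases x) auto
  have "least P (Face {}) (carrier P)" "greatest P One (carrier P)"
    using car bot top by (auto simp: least_def Lower_def greatest_def Upper_def le)
  moreover have "x = Face {}" if "least P x (carrier P)" for x
  proof -
    have "semi_le n x (Face {})"
      using that car le by (auto simp: least_def Lower_def)
    then show ?thesis
      using semi_le_antisym bot by blast
  qed
  moreover have "x = One" if "greatest P x (carrier P)" for x
  proof -
    have "semi_le n One x"
      using that car le by (auto simp: greatest_def Upper_def)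
    then show ?thesis
      using semi_le_antisym top by blast
  qed
  ultimately show "\<bottom>\<^bsub>P\<^esub> = Face {}" "\<top>\<^bsub>P\<^esub> = One"
    unfolding bottom_def top_def by (blast intro: some_equality)+
qed


section \<open>The simplicial shelling components\<close>

text \<open>The \<open>k\<close>-dimensional simplex has vertex set \<open>{..k}\<close>; its facets are the sets
  \<open>{..k} - {v}\<close>. Its automorphism group permutes the facets arbitrarily, so the choice of
  \<open>i + 1\<close> of them does not matter; we take those with \<open>v \<le> i\<close>.\<close>

definition Delta :: "nat \<Rightarrow> nat \<Rightarrow> nat set set" where
  "Delta k i = (\<Union>v\<in>{..i}. Pow ({..k} - {v}))"

lemma simplicial_complex_Delta: "simplicial_complex (Delta k i)"
proof -
  have "finite F" if "F \<in> Delta k i" for F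
    using that finite_subset[of F "{..k}"] by (auto simp: Delta_def)
  moreover have "finite (Delta k i)"
    by (simp add: Delta_def)
  moreover have "{} \<in> Delta k i"
    by (auto simp: Delta_def)
  moreover have "G \<in> Delta k i" if "F \<in> Delta k i" "G \<subseteq> F" for F G
    using that unfolding Delta_def by blast
  ultimately show ?thesis
    unfolding simplicial_complex_def by blast
qed

lemma face_dim_Delta:
  assumes "i \<le> k" "F \<in> Delta k i"
  shows "face_dim F < int k"
proof -
  obtain v where "v \<le> i" "F \<subseteq> {..k} - {v}"
    using assms(2) unfolding Delta_def by blast
  then have "card F \<le> k"
    using card_mono[of "{..k} - {v}" F] assms(1) by simp
  then show ?thesis
    by (simp add: face_dim_def)
qed

definition shelling_poset :: "nat \<Rightarrow> nat \<Rightarrow> nat \<Rightarrow> (nat semi_elem, 'r::field) qg_poset" where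
  "shelling_poset n k i = semi_face_poset (Delta k i) n"

lemma quasi_graded_shelling_poset:
  assumes "i \<le> k" "k \<le> n"
  shows "quasi_graded_poset (shelling_poset n k i :: (nat semi_elem, 'r::field) qg_poset)"
  unfolding shelling_poset_def
proof (rule quasi_graded_semi_face_poset[OF simplicial_complex_Delta])
  show "face_dim F < int n" if "F \<in> Delta k i" for F
    using face_dim_Delta[OF assms(1) that] assms(2) by linarith
qed

text \<open>The cd-index is the ab-index, rewritten in terms of \<open>c = a + b\<close> and \<open>d = ab + ba\<close>; it is
  kept here as an element of the ring of polynomials in a and b.\<close>

definition Phi_check :: "nat \<Rightarrow> nat \<Rightarrow> nat \<Rightarrow> 'r::field ab_poly" where
  "Phi_check n k i =
     (if i = 0 then ab_index (shelling_poset n k 0)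
      else ab_index (shelling_poset n k i) - ab_index (shelling_poset n k (i - 1)))"

end

theory Submission
  imports Defs
begin

text \<open>Expanding the link Euler characteristic in \<open>zeta F *\<close> as a sum over the faces \<open>H\<close>
  containing \<open>F\<close> and exchanging summations turns the ab-index of a semisuspension into a sum over
  all faces \<open>H\<close> of a weight that depends only on \<open>n\<close> and the cardinality of \<open>H\<close>. The faces added
  by the \<open>i\<close>-th shelling step form a Boolean interval of rank \<open>k - i\<close> above a set of size \<open>i\<close>,
  so \<open>Phi_check n k i\<close> is the sum of \<open>(k - i) choose r\<close> times the weight of \<open>i + r\<close>. By Pascal's
  rule these sums are iterated finite differences of the case \<open>i = 0\<close>.\<close>

section \<open>Binomial sums over Boolean intervals and their finite differences\<close>

text \<open>Removing \<open>U\<close> identifies the interval with the power set of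
  \<open>V - U\<close>, whose members are then grouped by size.\<close>

lemma sum_card_between:
  fixes f :: "nat \<Rightarrow> 'a::semiring_1"
  assumes "finite V" and "U \<subseteq> V"
  shows "(\<Sum>G | U \<subseteq> G \<and> G \<subseteq> V. f (card G)) =
    (\<Sum>r\<le>card V - card U. of_nat ((card V - card U) choose r) * f (card U + r))"
proof -
  define W where "W = V - U"
  have fin: "finite U" "finite W" and W: "card W = card V - card U" "U \<inter> W = {}" "V = U \<union> W"
    using assms by (auto simp: W_def card_Diff_subset finite_subset)
  have "(\<Sum>G | U \<subseteq> G \<and> G \<subseteq> V. f (card G)) = (\<Sum>X\<in>Pow W. f (card U + card X))"
    by (rule sum.reindex_bij_witness[of _ "\<lambda>X. U \<union> X" "\<lambda>G. G - U"])
      (use W fin in \<open>auto simp: card_Diff_subset card_mono finite_subset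
        card_Un_disjoint[symmetric] intro!: arg_cong[of _ _ f] arg_cong[of _ _ card]\<close>)
  also have "\<dots> = (\<Sum>r\<le>card W. \<Sum>X\<in>{X \<in> Pow W. card X = r}. f (card U + card X))"
    by (rule sum.group[symmetric]) (use fin in \<open>auto simp: card_mono\<close>)
  also have "\<dots> = (\<Sum>r\<le>card W. of_nat (card W choose r) * f (card U + r))"
  proof (rule sum.cong)
    fix r
    have "card {X \<in> Pow W. card X = r} = card W choose r"
      using n_subsets[OF fin(2), of r] by simp
    then show "(\<Sum>X\<in>{X \<in> Pow W. card X = r}. f (card U + card X)) =
        of_nat (card W choose r) * f (card U + r)"
      by simp
  qed simp
  finally show ?thesis
    by (simp add: W(1))
qed

text \<open>Pascal's rule splits each coefficient. It is applied below both to the number of summed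
  terms and to the order of the difference.\<close>

lemma binomial_sum_Suc:
  fixes f :: "nat \<Rightarrow> 'a::semiring_1"
  shows "(\<Sum>r\<le>Suc m. of_nat (Suc m choose r) * f r) =
    (\<Sum>r\<le>m. of_nat (m choose r) * f r) + (\<Sum>r\<le>m. of_nat (m choose r) * f (Suc r))"
proof -
  have "(\<Sum>r\<le>Suc m. of_nat (Suc m choose r) * f r) =
      (f 0 + (\<Sum>r\<le>m. of_nat (m choose Suc r) * f (Suc r)))
        + (\<Sum>r\<le>m. of_nat (m choose r) * f (Suc r))"
    unfolding sum.atMost_Suc_shift by (simp add: algebra_simps sum.distrib)
  also have "f 0 + (\<Sum>r\<le>m. of_nat (m choose Suc r) * f (Suc r)) =
      (\<Sum>r\<le>Suc m. of_nat (m choose r) * f r)"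
    unfolding sum.atMost_Suc_shift by simp
  \<comment> \<open>The surplus term of the last sum has coefficient \<open>m choose Suc m\<close>,
    which is 0.\<close>
  finally show ?thesis
    by (simp add: binomial_eq_0)
qed

text \<open>With E the shift of sequences, the left side is the value at 0 of (1+E)^m E^i f, and the
  right side expands E^i = ((1+E) - 1)^i by the binomial theorem. The induction replaces one factor
  E by (1+E) - 1 at a time.\<close>

lemma alternating_sum_binomial_sums:
  fixes f :: "nat \<Rightarrow> 'a::ring_1"
  shows "(\<Sum>r\<le>m. of_nat (m choose r) * f (i + r)) =
    (\<Sum>j\<le>i. of_nat (i choose j) *
      ((-1) ^ j * (\<Sum>r\<le>m + i - j. of_nat ((m + i - j) choose r) * f r)))"
proof (induction i arbitrary: f)
  case (Suc i)
  define S where "S f p = (\<Sum>r\<le>p. of_nat (p choose r) * f r)" for f :: "nat \<Rightarrow> 'a" and p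
  have S_shift: "S (\<lambda>r. f (Suc r)) p = S f (Suc p) - S f p" for p
    unfolding S_def binomial_sum_Suc by simp
  have "(\<Sum>r\<le>m. of_nat (m choose r) * f (Suc i + r)) =
      (\<Sum>j\<le>i. of_nat (i choose j) * ((-1) ^ j * S (\<lambda>r. f (Suc r)) (m + i - j)))"
    using Suc.IH[of "\<lambda>r. f (Suc r)"] by (simp add: S_def)
  also have "\<dots> = (\<Sum>j\<le>i. of_nat (i choose j) * ((-1) ^ j * S f (m + Suc i - j)))
      + (\<Sum>j\<le>i. of_nat (i choose j) * ((-1) ^ Suc j * S f (m + Suc i - Suc j)))"
    unfolding sum.distrib[symmetric]
    by (rule sum.cong) (simp_all add: S_shift Suc_diff_le right_diff_distrib)
  \<comment> \<open>Pascal's rule read backwards, now in \<open>i\<close>, for the sequence sending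
    \<open>j\<close> to \<open>(-1) ^ j * S f (m + Suc i - j)\<close>.\<close>
  also have "\<dots> = (\<Sum>j\<le>Suc i. of_nat (Suc i choose j) * ((-1) ^ j * S f (m + Suc i - j)))"
    by (rule binomial_sum_Suc[symmetric])
  finally show ?case
    by (simp add: S_def)
qed simp

section \<open>Constant polynomials and the recursion for chain sums\<close>

lemma const_ab_1 [simp]: "const_ab 1 = 1"
  by (simp add: const_ab_def)

lemma const_ab_add: "const_ab (x + y) = const_ab x + const_ab y"
  by (simp add: const_ab_def single_add)

lemma const_ab_sum: "const_ab (sum f I) = (\<Sum>x\<in>I. const_ab (f x))"
proof -
  have "const_ab (0 :: 'a) = 0"
    by (simp add: const_ab_def)
  then show ?thesis
    by (induction I rule: infinite_finite_induct) (simp_all add: const_ab_add)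
qed

text \<open>Frees the endpoints of \<open>chains\<close>, so that the first element of a chain can
  be split off recursively.\<close>

definition chains_from_to :: "('a, 'r) qg_poset \<Rightarrow> 'a \<Rightarrow> 'a \<Rightarrow> 'a list set" where
  "chains_from_to P x t = {xs. xs \<noteq> [] \<and> set xs \<subseteq> carrier P \<and> sorted_wrt (lless P) xs
                  \<and> hd xs = x \<and> last xs = t}"

definition chain_sum :: "('a, 'r::field) qg_poset \<Rightarrow> 'a \<Rightarrow> 'a \<Rightarrow> 'r ab_poly" where
  "chain_sum P x t = (\<Sum>xs\<in>chains_from_to P x t. chain_term P xs)"

lemma ab_index_eq_chain_sum: "ab_index P = chain_sum P \<bottom>\<^bsub>P\<^esub> \<top>\<^bsub>P\<^esub>"
  by (simp add: ab_index_def chain_sum_def chains_def chains_from_to_def)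

context quasi_graded_poset
begin

lemma finite_chains_from_to: "finite (chains_from_to P x t)"
proof (rule finite_subset)
  have "distinct xs" if "sorted_wrt (lless P) xs" for xs
    using that by (induction xs) (auto simp: lless_def eq_is_equal)
  then show "chains_from_to P x t \<subseteq> {xs. set xs \<subseteq> carrier P \<and> distinct xs}"
    by (auto simp: chains_from_to_def)
  show "finite {xs. set xs \<subseteq> carrier P \<and> distinct xs}"
    using finite_carrier by (rule finite_subset_distinct)
qed

lemma chains_from_to_refl:
  assumes "t \<in> carrier P"
  shows "chains_from_to P t t = {[t]}"
proof -
  have "xs = [t]" if "xs \<in> chains_from_to P t t" for xs
  proof (cases xs)
    case (Cons y ys)
    with that have "y = t" "ys \<noteq> [] \<Longrightarrow> t \<sqsubset> last ys" "ys \<noteq> [] \<Longrightarrow> last ys = t"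
      by (auto simp: chains_from_to_def)
    then show ?thesis
      using Cons by (auto simp: lless_def eq_is_equal)
  qed (use that in \<open>simp add: chains_from_to_def\<close>)
  moreover have "[t] \<in> chains_from_to P t t"
    using assms by (simp add: chains_from_to_def)
  ultimately show ?thesis
    by blast
qed

lemma chains_from_to_step:
  assumes "x \<in> carrier P" and "x \<noteq> t"
  shows "chains_from_to P x t =
    (\<Union>y\<in>{y \<in> carrier P. x \<sqsubset> y}. Cons x ` chains_from_to P y t)" (is "_ = ?R")
proof (intro Set.set_eqI iffI)
  fix xs
  assume xs: "xs \<in> chains_from_to P x t"
  then obtain ys where ys: "xs = x # ys"
    by (cases xs) (auto simp: chains_from_to_def)
  with xs assms have "ys \<noteq> []"
    by (auto simp: chains_from_to_def)
  then have "ys \<in> chains_from_to P (hd ys) t" "hd ys \<in> carrier P" "x \<sqsubset> hd ys"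
    using xs ys by (auto simp: chains_from_to_def)
  then show "xs \<in> ?R"
    using ys by blast
next
  fix xs
  assume "xs \<in> ?R"
  then obtain y ys where y: "y \<in> carrier P" "x \<sqsubset> y" "ys \<in> chains_from_to P y t" "xs = x # ys"
    by blast
  then obtain zs where zs: "ys = y # zs"
    by (cases ys) (auto simp: chains_from_to_def)
  \<comment> \<open>\<open>sorted_wrt\<close> compares \<open>x\<close> with every later entry, not
    only with its successor \<open>y\<close>.\<close>
  have "x \<sqsubset> z" if "z \<in> set zs" for z
    using that y zs assms lless_trans[of x y z] by (auto simp: chains_from_to_def)
  then show "xs \<in> chains_from_to P x t"
    using y zs assms by (auto simp: chains_from_to_def)
qed

lemma chain_sum_refl: "t \<in> carrier P \<Longrightarrow> chain_sum P t t = 1"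
  by (simp add: chain_sum_def chains_from_to_refl)

text \<open>Chains are sorted by their second element \<open>y\<close>. A factor \<open>bvar\<close>
  stands only between two consecutive steps, so none appears when the first step already ends at
  \<open>t\<close>.\<close>

lemma chain_sum_step:
  assumes "x \<in> carrier P" and "t \<in> carrier P" and "x \<noteq> t"
  shows "chain_sum P x t = (\<Sum>y | y \<in> carrier P \<and> x \<sqsubset> y.
    const_ab (zeta P x y) * (avar - bvar) ^ (rk P y - rk P x - 1) *
      (if y = t then 1 else bvar * chain_sum P y t))"
proof -
  have "chain_sum P x t =
      (\<Sum>y | y \<in> carrier P \<and> x \<sqsubset> y. \<Sum>xs\<in>Cons x ` chains_from_to P y t. chain_term P xs)"
    unfolding chain_sum_def chains_from_to_step[OF assms(1,3)]
    by (rule sum.UNION_disjoint)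
      \<comment> \<open>The pieces are disjoint because \<open>y\<close> is the second entry of each
        chain in its piece.\<close>
      (auto simp: finite_carrier finite_chains_from_to, auto simp: chains_from_to_def)
  also have "\<dots> = (\<Sum>y | y \<in> carrier P \<and> x \<sqsubset> y.
    const_ab (zeta P x y) * (avar - bvar) ^ (rk P y - rk P x - 1) *
      (if y = t then 1 else bvar * chain_sum P y t))"
  proof (rule sum.cong)
    fix y
    assume y: "y \<in> {y. y \<in> carrier P \<and> x \<sqsubset> y}"
    have "(\<Sum>xs\<in>Cons x ` chains_from_to P y t. chain_term P xs) =
        (\<Sum>ys\<in>chains_from_to P y t. chain_term P (x # ys))"
      by (subst sum.reindex) auto
    also have "\<dots> = const_ab (zeta P x y) * (avar - bvar) ^ (rk P y - rk P x - 1) *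
      (if y = t then 1 else bvar * chain_sum P y t)"
    proof (cases "y = t")
      case True
      then show ?thesis
        using assms by (simp add: chains_from_to_refl)
    next
      case False
      have "chain_term P (x # ys) =
          const_ab (zeta P x y) * (avar - bvar) ^ (rk P y - rk P x - 1) * bvar * chain_term P ys"
        if ys: "ys \<in> chains_from_to P y t" for ys
      proof -
        obtain z zs where "ys = y # z # zs"
          using ys False by (cases ys; cases "tl ys") (auto simp: chains_from_to_def)
        then show ?thesis
          by simp
      qed
      then show ?thesis
        using False by (simp add: chain_sum_def sum_distrib_left mult.assoc)
    qed
    finally show "(\<Sum>xs\<in>Cons x ` chains_from_to P y t. chain_term P xs) = \<dots>" .
  qed simp
  finally show ?thesis .
qed

end

section \<open>The weight of a face in the chain sum\<close>

text \<open>The share of a face with \<open>t\<close> vertices in the chains \<open>F < 1\<close> and \<open>F < * < 1\<close>, where \<open>F\<close> has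
  \<open>s\<close> vertices: the link Euler characteristic in \<open>zeta F *\<close> is spread over the faces
  containing \<open>F\<close>. The exponent of \<open>powi\<close> is \<open>-1\<close> for \<open>s = t\<close>.\<close>

definition direct_kernel :: "nat \<Rightarrow> nat \<Rightarrow> nat \<Rightarrow> 'r::field ab_poly" where
  "direct_kernel n s t =
     (if s = t then (avar - bvar) ^ (n - s) else 0) +
     (if s < n then (if s = t then (avar - bvar) ^ (n - s - 1) * bvar else 0) +
        const_ab ((-1) ^ (n - s) * (-1) powi (int t - int s - 1)) *
          ((avar - bvar) ^ (n - s - 1) * bvar)
      else 0)"

text \<open>The coefficient of a face H with \<open>t\<close> vertices in the chain sum from a face
  F with \<open>s\<close> vertices. Here \<open>r\<close> is the number of vertices by which the
  next face of the chain exceeds F, and the binomial counts such faces inside H.\<close>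

function ab_kernel :: "nat \<Rightarrow> nat \<Rightarrow> nat \<Rightarrow> 'r::field ab_poly" where
  "ab_kernel n s t = direct_kernel n s t +
     (\<Sum>r\<in>{1..t - s}. of_nat ((t - s) choose r) *
        ((avar - bvar) ^ (r - 1) * bvar * ab_kernel n (s + r) t))"
  by auto
termination
  by (relation "measure (\<lambda>(n, s, t). t - s)") auto

declare ab_kernel.simps [simp del]

text \<open>Turns the numerical recursion of \<open>ab_kernel\<close> into a sum over actual faces,
  the form in which it meets the recursion for chain sums.\<close>

lemma kernel_eq_sum_between:
  assumes "finite H" and "F \<subseteq> H"
  shows "(ab_kernel n (card F) (card H) :: 'r::field ab_poly) = direct_kernel n (card F) (card H) +
    (\<Sum>G | F \<subset> G \<and> G \<subseteq> H. (avar - bvar) ^ (card G - card F - 1) * bvar * ab_kernel n (card G) (card H))"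
proof -
  let ?s = "card F" and ?d = "card H - card F"
  \<comment> \<open>At \<open>g = card F\<close> the exponent is truncated to 0. This spurious value
    occurs once in each of the two splittings below and cancels.\<close>
  define f :: "nat \<Rightarrow> 'r ab_poly"
    where "f g = (avar - bvar) ^ (g - ?s - 1) * bvar * ab_kernel n g (card H)" for g
  have fin: "finite {G. F \<subseteq> G \<and> G \<subseteq> H}"
    using assms(1) by simp
  have "(\<Sum>G | F \<subseteq> G \<and> G \<subseteq> H. f (card G)) = f ?s + (\<Sum>G | F \<subset> G \<and> G \<subseteq> H. f (card G))"
    using sum.remove[OF fin, of F "\<lambda>G. f (card G)"] assms(2)
    by (auto intro!: sum.cong)
  moreover have "(\<Sum>r\<le>?d. of_nat (?d choose r) * f (?s + r)) =
      f ?s + (\<Sum>r\<in>{1..?d}. of_nat (?d choose r) * f (?s + r))"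
    by (simp add: atMost_atLeast0 sum.atLeast_Suc_atMost)
  ultimately have "(\<Sum>G | F \<subset> G \<and> G \<subseteq> H. f (card G)) =
      (\<Sum>r\<in>{1..?d}. of_nat (?d choose r) * f (?s + r))"
    using sum_card_between[OF assms, of f] by simp
  then show ?thesis
    unfolding ab_kernel.simps[of n ?s "card H"] by (simp add: f_def)
qed

section \<open>The ab-index of a semisuspension as a sum over faces\<close>

locale semisuspension =
  fixes \<Delta> :: "'v set set" and n :: nat
  assumes complex: "simplicial_complex \<Delta>"
    and face_dim_less: "\<And>F. F \<in> \<Delta> \<Longrightarrow> face_dim F < int n"
    and n_pos: "n \<ge> 1"
begin

abbreviation S :: "('v semi_elem, 'r::field) qg_poset" where
  "S \<equiv> semi_face_poset \<Delta> n"

lemma finite_faces: "finite \<Delta>" and finite_face: "F \<in> \<Delta> \<Longrightarrow> finite F"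
  and face_subset: "F \<in> \<Delta> \<Longrightarrow> G \<subseteq> F \<Longrightarrow> G \<in> \<Delta>" and empty_face: "{} \<in> \<Delta>"
  using complex by (auto simp: simplicial_complex_def)

lemma card_face_le: "F \<in> \<Delta> \<Longrightarrow> card F \<le> n"
  using face_dim_less[of F] by (simp add: face_dim_def)

lemma rk_S [simp]: "rk S (Face F) = card F" "rk S Star = n" "rk S One = n + 1"
  by (simp_all add: semi_face_poset_def face_dim_def)

lemma chain_sum_Star: "(chain_sum S Star One :: 'r::field ab_poly) = 1"
proof -
  interpret quasi_graded_poset "S :: ('v semi_elem, 'r) qg_poset"
    using quasi_graded_semi_face_poset[OF complex face_dim_less] .
  have "{y. y \<in> carrier (S :: ('v semi_elem, 'r) qg_poset) \<and> Star \<sqsubset>\<^bsub>S :: ('v semi_elem, 'r) qg_poset\<^esub> y} = {One}"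
    by (auto simp: semi_face_poset_def lless_def)
  then show ?thesis
    by (subst chain_sum_step) (simp_all add: semi_face_poset_def)
qed

text \<open>The three summands belong to the possible second elements of a chain:
  \<open>One\<close>, \<open>Star\<close> and a larger face. After \<open>Star\<close> only the step
  to \<open>One\<close> of rank difference 1 remains, which leaves the bare factor
  \<open>bvar\<close>.\<close>

lemma chain_sum_Face_step:
  assumes "F \<in> \<Delta>"
  shows "(chain_sum S (Face F) One :: 'r::field ab_poly) =
    (avar - bvar) ^ (n - card F) +
    (if card F < n then const_ab (semi_zeta \<Delta> n (Face F) Star) * ((avar - bvar) ^ (n - card F - 1) * bvar)
     else 0) +
    (\<Sum>G | G \<in> \<Delta> \<and> F \<subset> G. (avar - bvar) ^ (card G - card F - 1) * bvar * chain_sum S (Face G) One)"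
proof -
  let ?P = "S :: ('v semi_elem, 'r) qg_poset"
  interpret quasi_graded_poset ?P
    using quasi_graded_semi_face_poset[OF complex face_dim_less] .
  define Y where "Y = {y. y \<in> carrier ?P \<and> Face F \<sqsubset>\<^bsub>?P\<^esub> y}"
  define h where "h y = const_ab (zeta ?P (Face F) y) * (avar - bvar) ^ (rk ?P y - rk ?P (Face F) - 1) *
      (if y = One then 1 else bvar * chain_sum ?P y One)" for y
  have Y: "Y = insert One ((if card F < n then {Star} else {}) \<union> Face ` {G \<in> \<Delta>. F \<subset> G})"
  proof (rule Set.set_eqI)
    fix y
    show "y \<in> Y \<longleftrightarrow> y \<in> insert One ((if card F < n then {Star} else {}) \<union> Face ` {G \<in> \<Delta>. F \<subset> G})"
      by (cases y) (simp_all add: Y_def semi_face_poset_def lless_def psubset_eq image_iff)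
  qed
  have "chain_sum ?P (Face F) One = sum h Y"
    unfolding Y_def h_def by (rule chain_sum_step) (use assms in \<open>auto simp: semi_face_poset_def\<close>)
  also have "\<dots> = h One + (if card F < n then h Star else 0) + (\<Sum>G | G \<in> \<Delta> \<and> F \<subset> G. h (Face G))"
  proof -
    have "sum h (Face ` {G \<in> \<Delta>. F \<subset> G}) = (\<Sum>G | G \<in> \<Delta> \<and> F \<subset> G. h (Face G))"
      by (subst sum.reindex) (auto simp: inj_on_def)
    moreover have "sum h Y = h One + (if card F < n then h Star else 0) + sum h (Face ` {G \<in> \<Delta>. F \<subset> G})"
    proof -
      let ?I = "Face ` {G \<in> \<Delta>. F \<subset> G}"
      have I: "finite ?I" "One \<notin> ?I" "Star \<notin> ?I"
        using finite_faces by auto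
      then show ?thesis
        unfolding Y by (simp add: add.assoc)
    qed
    ultimately show ?thesis
      by simp
  qed
  \<comment> \<open>\<open>One\<close> has rank \<open>n + 1\<close>, which absorbs the
    \<open>- 1\<close> in the exponent.\<close>
  also have "h One = (avar - bvar) ^ (n - card F)"
    by (simp add: h_def) (simp add: semi_face_poset_def)
  also have "h Star = const_ab (semi_zeta \<Delta> n (Face F) Star) * ((avar - bvar) ^ (n - card F - 1) * bvar)"
    by (simp add: h_def chain_sum_Star mult.assoc) (simp add: semi_face_poset_def)
  also have "(\<Sum>G | G \<in> \<Delta> \<and> F \<subset> G. h (Face G)) =
      (\<Sum>G | G \<in> \<Delta> \<and> F \<subset> G. (avar - bvar) ^ (card G - card F - 1) * bvar * chain_sum S (Face G) One)"
    by (rule sum.cong) (simp_all add: h_def mult.assoc, simp add: semi_face_poset_def)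
  finally show ?thesis .
qed

text \<open>Recovers the first two summands of \<open>chain_sum_Face_step\<close>: the terms guarded
  by \<open>s = t\<close> survive only for \<open>H = F\<close>, and the others add up to the link
  Euler characteristic.\<close>

lemma sum_direct_kernel:
  assumes "F \<in> \<Delta>"
  shows "(\<Sum>H | H \<in> \<Delta> \<and> F \<subseteq> H. direct_kernel n (card F) (card H)) =
    (avar - bvar) ^ (n - card F) +
    (if card F < n then const_ab (semi_zeta \<Delta> n (Face F) Star :: 'r::field)
        * ((avar - bvar) ^ (n - card F - 1) * bvar) else 0)"
proof -
  let ?T = "{H. H \<in> \<Delta> \<and> F \<subseteq> H}"
  have fin: "finite ?T" and F: "F \<in> ?T"
    using finite_faces assms by auto
  have eq: "card F = card H \<longleftrightarrow> F = H" if "H \<in> ?T" for H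
    using that card_subset_eq[of H F] finite_face by auto
  have delta: "(\<Sum>H\<in>?T. if card F = card H then x else 0) = x" for x :: "'r ab_poly"
  proof -
    have "(\<Sum>H\<in>?T. if card F = card H then x else 0) = (\<Sum>H\<in>?T. if F = H then x else 0)"
      by (rule sum.cong) (simp_all add: eq)
    also have "\<dots> = x"
      using fin F by simp
    finally show ?thesis .
  qed
  have zeta: "const_ab (semi_zeta \<Delta> n (Face F) Star :: 'r) =
      1 + (\<Sum>H\<in>?T. const_ab ((-1) ^ (n - card F) * (-1) powi (int (card H) - int (card F) - 1)))"
    by (simp add: link_euler_def face_dim_def const_ab_add const_ab_sum sum_distrib_left)
  show ?thesis
  proof (cases "card F < n")
    case True
    show ?thesis
      by (simp only: direct_kernel_def True if_True sum.distrib delta zeta distrib_right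
          mult_1_left sum_distrib_right)
  next
    case False
    then show ?thesis
      by (simp add: direct_kernel_def delta)
  qed
qed

text \<open>After the induction hypothesis is inserted and the sums over G and H are exchanged, each
  H carries exactly the recursion of \<open>kernel_eq_sum_between\<close>.\<close>

lemma chain_sum_Face:
  assumes "F \<in> \<Delta>"
  shows "(chain_sum S (Face F) One :: 'r::field ab_poly) =
    (\<Sum>H | H \<in> \<Delta> \<and> F \<subseteq> H. ab_kernel n (card F) (card H))"
  using assms
\<comment> \<open>The measure drops for a larger face because faces have at most \<open>n\<close>
  vertices.\<close>
proof (induction "n - card F" arbitrary: F rule: less_induct)
  case less
  let ?c = "\<lambda>G. (avar - bvar) ^ (card G - card F - 1) * bvar :: 'r ab_poly"
  have "(\<Sum>G | G \<in> \<Delta> \<and> F \<subset> G. ?c G * chain_sum S (Face G) One) =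
      (\<Sum>G | G \<in> \<Delta> \<and> F \<subset> G. \<Sum>H | H \<in> \<Delta> \<and> G \<subseteq> H. ?c G * ab_kernel n (card G) (card H))"
  proof (rule sum.cong)
    fix G
    assume "G \<in> {G. G \<in> \<Delta> \<and> F \<subset> G}"
    then have G: "G \<in> \<Delta>" and "card F < card G"
      by (auto intro: psubset_card_mono finite_face)
    with less.hyps[of G] card_face_le[of G] show "?c G * chain_sum S (Face G) One =
        (\<Sum>H | H \<in> \<Delta> \<and> G \<subseteq> H. ?c G * ab_kernel n (card G) (card H))"
      by (simp add: sum_distrib_left)
  qed simp
  also have "\<dots> = (\<Sum>H | H \<in> \<Delta> \<and> F \<subseteq> H. \<Sum>G | F \<subset> G \<and> G \<subseteq> H. ?c G * ab_kernel n (card G) (card H))"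
  proof -
    have "(\<Sum>G | G \<in> \<Delta> \<and> F \<subset> G. \<Sum>H | H \<in> \<Delta> \<and> G \<subseteq> H. ?c G * ab_kernel n (card G) (card H)) =
        (\<Sum>G | G \<in> \<Delta> \<and> F \<subset> G. \<Sum>H | H \<in> {H. H \<in> \<Delta> \<and> F \<subseteq> H} \<and> G \<subseteq> H. ?c G * ab_kernel n (card G) (card H))"
      by (intro sum.cong) auto
    also have "\<dots> = (\<Sum>H | H \<in> \<Delta> \<and> F \<subseteq> H. \<Sum>G | G \<in> {G. G \<in> \<Delta> \<and> F \<subset> G} \<and> G \<subseteq> H. ?c G * ab_kernel n (card G) (card H))"
      by (rule sum.swap_restrict) (use finite_faces in auto)
    \<comment> \<open>Subsets of a face are faces, so the inner sum runs over a full Boolean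
      interval.\<close>
    also have "\<dots> = (\<Sum>H | H \<in> \<Delta> \<and> F \<subseteq> H. \<Sum>G | F \<subset> G \<and> G \<subseteq> H. ?c G * ab_kernel n (card G) (card H))"
      by (intro sum.cong) (auto intro: face_subset)
    finally show ?thesis .
  qed
  finally have "chain_sum S (Face F) One =
      (\<Sum>H | H \<in> \<Delta> \<and> F \<subseteq> H. direct_kernel n (card F) (card H) +
        (\<Sum>G | F \<subset> G \<and> G \<subseteq> H. ?c G * ab_kernel n (card G) (card H)))"
    unfolding chain_sum_Face_step[OF less.prems] sum.distrib sum_direct_kernel[OF less.prems]
    by simp
  also have "\<dots> = (\<Sum>H | H \<in> \<Delta> \<and> F \<subseteq> H. ab_kernel n (card F) (card H))"
    by (rule sum.cong) (auto simp: kernel_eq_sum_between finite_face)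
  finally show ?case .
qed

lemma ab_index_semisuspension:
  "ab_index S = (\<Sum>F\<in>\<Delta>. ab_kernel n 0 (card F))"
  unfolding ab_index_eq_chain_sum bottom_top_semi_face_poset[OF complex n_pos]
  using chain_sum_Face[OF empty_face] by simp

end

section \<open>The simplicial shelling components\<close>

lemma ab_index_shelling_poset:
  assumes "i \<le> k" and "k \<le> n" and "n \<ge> 1"
  shows "ab_index (shelling_poset n k i) = (\<Sum>F\<in>Delta k i. ab_kernel n 0 (card F))"
proof -
  have "face_dim F < int n" if "F \<in> Delta k i" for F
    using face_dim_Delta[OF assms(1) that] assms(2) by linarith
  then interpret semisuspension "Delta k i" n
    using assms(3) simplicial_complex_Delta by unfold_locales
  show ?thesis
    unfolding shelling_poset_def by (rule ab_index_semisuspension)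
qed

text \<open>The lower end \<open>{..<0}\<close> gives this the same interval form as the later
  shelling steps, so one formula covers all \<open>i\<close>.\<close>

lemma Delta_0: "Delta k 0 = {F. {..<0} \<subseteq> F \<and> F \<subseteq> {..k} - {0}}"
  by (auto simp: Delta_def)

text \<open>A subset of \<open>{..k}\<close> lies outside \<open>Delta k i\<close> exactly if it
  contains \<open>{..i}\<close>. A new face therefore contains \<open>{..i}\<close> and, being in
  the larger complex, omits \<open>Suc i\<close>.\<close>

lemma Delta_Suc_diff: "Delta k (Suc i) - Delta k i = {F. {..<Suc i} \<subseteq> F \<and> F \<subseteq> {..k} - {Suc i}}"
proof -
  have Delta_iff: "F \<in> Delta k i \<longleftrightarrow> F \<subseteq> {..k} \<and> \<not> {..i} \<subseteq> F" for F i
    unfolding Delta_def by blast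
  have "F \<in> Delta k (Suc i) - Delta k i \<longleftrightarrow> {..<Suc i} \<subseteq> F \<and> F \<subseteq> {..k} - {Suc i}" for F
    unfolding Diff_iff Delta_iff lessThan_Suc_atMost atMost_Suc[of i] insert_subset
      subset_Diff_insert Diff_empty by argo
  then show ?thesis
    by blast
qed

text \<open>The complexes are nested, so the difference of ab-indices is the sum over the added
  faces. These form a Boolean interval from a set of size \<open>i\<close> to one of size
  \<open>k\<close>.\<close>

lemma Phi_check_eq:
  assumes "i \<le> k" and "k \<le> n" and "n \<ge> 1"
  shows "Phi_check n k i = (\<Sum>r\<le>k - i. of_nat ((k - i) choose r) * ab_kernel n 0 (i + r))"
proof -
  have "Phi_check n k i = (\<Sum>F | {..<i} \<subseteq> F \<and> F \<subseteq> {..k} - {i}. ab_kernel n 0 (card F))"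
  proof (cases i)
    case 0
    then show ?thesis
      using assms by (simp add: Phi_check_def ab_index_shelling_poset Delta_0)
  next
    case (Suc i')
    have "Delta k i' \<subseteq> Delta k (Suc i')"
      unfolding Delta_def by (intro UN_mono) auto
    moreover have "finite (Delta k (Suc i'))"
      using simplicial_complex_Delta[of k "Suc i'"] by (simp add: simplicial_complex_def)
    ultimately show ?thesis
      using assms Suc
      by (simp add: Phi_check_def ab_index_shelling_poset sum_diff[symmetric] Delta_Suc_diff)
  qed
  also have "\<dots> = (\<Sum>r\<le>k - i. of_nat ((k - i) choose r) * ab_kernel n 0 (i + r))"
    by (subst sum_card_between) (use assms in auto)
  finally show ?thesis .
qed

theorem corollary14p5:
  fixes n k i :: nat
  assumes "i \<le> k" and "k \<le> n" and "n \<ge> 1"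
  shows "(Phi_check n k i :: 'r::field ab_poly) =
    (\<Sum>j = 0..i. (-1) ^ j * of_nat (i choose j) * Phi_check n (k - j) 0)"
proof -
  let ?B = "\<lambda>p. \<Sum>r\<le>p. of_nat (p choose r) * ab_kernel n 0 r :: 'r ab_poly"
  have "Phi_check n k i = (\<Sum>j\<le>i. of_nat (i choose j) * ((-1) ^ j * ?B (k - i + i - j)))"
    unfolding Phi_check_eq[OF assms] by (rule alternating_sum_binomial_sums)
  also have "\<dots> = (\<Sum>j = 0..i. (-1) ^ j * of_nat (i choose j) * Phi_check n (k - j) 0)"
  proof (rule sum.cong)
    fix j
    have "Phi_check n (k - j) 0 = ?B (k - j)"
      using assms by (subst Phi_check_eq) auto
    \<comment> \<open>The ring is not commutative, but values of \<open>of_nat\<close> commute with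
      everything.\<close>
    then show "of_nat (i choose j) * ((-1) ^ j * ?B (k - i + i - j)) =
        (-1) ^ j * of_nat (i choose j) * Phi_check n (k - j) 0"
      using assms(1) by (simp add: mult.assoc[symmetric] mult_of_nat_commute)
  qed auto
  finally show ?thesis .
qed

end
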